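(* Let $E$ be an atomless vector lattice with the projection property and $F$ a Dedekind complete vector lattice. Then a positive laterally continuous abstract Uryson operator $T: E \to F$ is $\lambda$-narrow if and only if it is pseudo-narrow.
   Context: Vector lattices are real. In a vector lattice $E$, an element $u>0$ is an atom if $0\le x\le u$, $0\le y\le u$, $x\wedge y=0$ imply $x=0$ or $y=0$; $E$ is atomless if it has no atom. $E$ has the projection property if every band of $E$ is a projection band. For $x,y\in E$, $x\perp y$ means $|x|\wedge|y|=0$. An element $y$ is a fragment of $x$, written $y\sqsubseteq x$, if $y\perp(x-y)$; $\mathfrak F_x$ is the set of all fragments of $x$. The notation $x=\bigsqcup_{i}x_i$ (finite) means $x=\sum_i x_i$ with the $x_i$ pairwise disjoint. $\Pi_x$ is the collection of all finite subsets $\pi\subset\mathfrak F_x$ with $x=\bigsqcup_{y\in\pi}y$. A net $(x_\alpha)$ order converges to $x$ if there is a net $(u_\alpha)$ with the same index set such that $u_\alpha\downarrow0$ and $|x_\alpha-x|\le u_\alpha$ for all $\alpha$; it laterally converges to $x$ if $x_\alpha\sqsubseteq x_\beta\sqsubseteq x$ for all $\alpha<\beta$ and $x_\alpha$ order converges to $x$. A (not necessarily linear) map $T:E\to F$ between vector lattices is orthogonally additive if $T(x+y)=T(x)+T(y)$ whenever $x\perp y$. An abstract Uryson operator is an orthogonally additive map sending order bounded sets to order bounded sets; $\mathcal U(E,F)$ denotes the set of these, ordered by $S\le T$ iff $T(x)-S(x)\ge0$ for all $x\in E$. In particular $T$ is positive if $T(x)\ge0$ for all $x\in E$, and $0<S$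 means $0\le S$, $S\ne0$. For $F$ Dedekind complete, $\mathcal U(E,F)$ is a Dedekind complete vector lattice and $|T|$ denotes the modulus in it ($|T|=T$ for $T$ positive). $T$ is laterally continuous if $T(x_\alpha)$ order converges to $T(x)$ whenever $(x_\alpha)$ laterally converges to $x$. $T$ is disjointness preserving if $T(x)\perp T(y)$ whenever $x\perp y$. For $F$ Dedekind complete and $T\in\mathcal U(E,F)$ put $\lambda_T(x)=\bigwedge_{\pi\in\Pi_x}\bigvee_{y\in\pi}|T(y)|$ for $x\in E$. $T$ is $\lambda$-narrow if $\lambda_T(x)=0$ for every $x\in E$. $T$ is pseudo-narrow if there is no disjointness preserving $S\in\mathcal U(E,F)$ with $0<S\le|T|$. *)

theory Defs
  imports Complex_Main "HOL-Library.Lattice_Algebras" "HOL-Library.Lub_Glb"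
begin

section \<open>Vector lattices\<close>

class vector_lattice = ordered_real_vector + lattice_ab_group_add_abs

class dedekind_complete_vector_lattice = vector_lattice + conditionally_complete_lattice

instance real :: dedekind_complete_vector_lattice ..

definition is_atom :: "'a::vector_lattice \<Rightarrow> bool" where
  "is_atom u \<longleftrightarrow> 0 < u \<and>
     (\<forall>x y. 0 \<le> x \<and> x \<le> u \<and> 0 \<le> y \<and> y \<le> u \<and> inf x y = 0 \<longrightarrow> x = 0 \<or> y = 0)"

definition atomless :: "'a::vector_lattice itself \<Rightarrow> bool" where
  "atomless _ \<longleftrightarrow> (\<nexists>u::'a. is_atom u)"

definition perp :: "'a::vector_lattice \<Rightarrow> 'a \<Rightarrow> bool"  (infix \<open>\<perp>\<close> 50) where
  "x \<perp> y \<longleftrightarrow> inf \<bar>x\<bar> \<bar>y\<bar> = 0"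

definition order_ideal :: "'a::vector_lattice set \<Rightarrow> bool" where
  "order_ideal B \<longleftrightarrow> subspace B \<and> (\<forall>x y. y \<in> B \<and> \<bar>x\<bar> \<le> \<bar>y\<bar> \<longrightarrow> x \<in> B)"

definition band :: "'a::vector_lattice set \<Rightarrow> bool" where
  "band B \<longleftrightarrow> order_ideal B \<and> (\<forall>D s. D \<subseteq> B \<and> isLub UNIV D s \<longrightarrow> s \<in> B)"

definition disjoint_complement :: "'a::vector_lattice set \<Rightarrow> 'a set" where
  "disjoint_complement B = {x. \<forall>b\<in>B. x \<perp> b}"

text \<open>The sum of a band and its disjoint complement is automatically direct.\<close>

definition projection_band :: "'a::vector_lattice set \<Rightarrow> bool" where
  "projection_band B \<longleftrightarrow> band B \<and> (\<forall>x. \<exists>b\<in>B. \<exists>c\<in>disjoint_complement B. x = b + c)"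

definition projection_property :: "'a::vector_lattice itself \<Rightarrow> bool" where
  "projection_property _ \<longleftrightarrow> (\<forall>B::'a set. band B \<longrightarrow> projection_band B)"

section \<open>Fragments\<close>

definition fragment :: "'a::vector_lattice \<Rightarrow> 'a \<Rightarrow> bool"  (infix \<open>\<sqsubseteq>\<close> 50) where
  "y \<sqsubseteq> x \<longleftrightarrow> y \<perp> (x - y)"

definition fragments :: "'a::vector_lattice \<Rightarrow> 'a set" where
  "fragments x = {y. y \<sqsubseteq> x}"

text \<open>The condition \<open>\<pi> \<noteq> {}\<close> only matters for \<open>x = 0\<close>: it excludes the empty decomposition of
  \<open>0\<close>, over which the supremum in \<open>lambda_fun\<close> below would be unspecified.\<close>

definition fragment_partitions :: "'a::vector_lattice \<Rightarrow> 'a set set" where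
  "fragment_partitions x =
     {\<pi>. finite \<pi> \<and> \<pi> \<noteq> {} \<and> \<pi> \<subseteq> fragments x \<and> pairwise (\<perp>) \<pi> \<and> x = \<Sum>\<pi>}"

section \<open>Nets\<close>

text \<open>A net is a function on a directed set \<open>(I, le)\<close>, given by a nonempty carrier and a relation
  on it.\<close>

definition directed_set :: "'i set \<Rightarrow> ('i \<Rightarrow> 'i \<Rightarrow> bool) \<Rightarrow> bool" where
  "directed_set I le \<longleftrightarrow> I \<noteq> {} \<and> reflp_on I le \<and> transp_on I le \<and>
     (\<forall>i\<in>I. \<forall>j\<in>I. \<exists>k\<in>I. le i k \<and> le j k)"

definition decreases_to_zero ::
  "'i set \<Rightarrow> ('i \<Rightarrow> 'i \<Rightarrow> bool) \<Rightarrow> ('i \<Rightarrow> 'a::vector_lattice) \<Rightarrow> bool" where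
  "decreases_to_zero I le u \<longleftrightarrow>
     (\<forall>i\<in>I. \<forall>j\<in>I. le i j \<longrightarrow> u j \<le> u i) \<and> isGlb UNIV (u ` I) 0"

definition order_converges ::
  "'i set \<Rightarrow> ('i \<Rightarrow> 'i \<Rightarrow> bool) \<Rightarrow> ('i \<Rightarrow> 'a::vector_lattice) \<Rightarrow> 'a \<Rightarrow> bool" where
  "order_converges I le x l \<longleftrightarrow>
     (\<exists>u. decreases_to_zero I le u \<and> (\<forall>i\<in>I. \<bar>x i - l\<bar> \<le> u i))"

definition laterally_converges ::
  "'i set \<Rightarrow> ('i \<Rightarrow> 'i \<Rightarrow> bool) \<Rightarrow> ('i \<Rightarrow> 'a::vector_lattice) \<Rightarrow> 'a \<Rightarrow> bool" where
  "laterally_converges I le x l \<longleftrightarrow>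
     (\<forall>i\<in>I. \<forall>j\<in>I. le i j \<and> i \<noteq> j \<longrightarrow> x i \<sqsubseteq> x j) \<and> (\<forall>i\<in>I. x i \<sqsubseteq> l) \<and> order_converges I le x l"

text \<open>HOL cannot quantify over the type of the indices, so the definition uses index sets contained
  in the domain of \<open>T\<close>. By \<open>laterally_continuousD\<close> below, this already gives the
  property for nets with indices of an arbitrary type.\<close>

definition laterally_continuous ::
  "('a::vector_lattice \<Rightarrow> 'b::vector_lattice) \<Rightarrow> bool" where
  "laterally_continuous T \<longleftrightarrow>
     (\<forall>(I::'a set) le x l. directed_set I le \<and> laterally_converges I le x l \<longrightarrow>
        order_converges I le (\<lambda>i. T (x i)) (T l))"

lemma inf_add_le:
  fixes a b c :: "'a::vector_lattice"
  assumes "0 \<le> a" "0 \<le> b" "0 \<le> c"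
  shows "inf a (b + c) \<le> inf a b + inf a c"
proof -
  define d where "d = inf a (b + c)"
  define e where "e = inf a b"
  have d: "d \<le> a" "d \<le> b + c"
    by (simp_all add: d_def)
  have e0: "0 \<le> e"
    using assms by (simp add: e_def)
  have "d - c \<le> b"
    using d(2) by (simp add: algebra_simps)
  moreover have "d - c \<le> a"
    using d(1) assms(3) by (meson diff_le_eq order_trans le_add_same_cancel1)
  ultimately have "d - c \<le> e"
    by (simp add: e_def)
  then have "d - e \<le> c"
    by (simp add: algebra_simps)
  moreover have "d - e \<le> a"
    using d(1) e0 by (meson diff_le_eq order_trans le_add_same_cancel1)
  ultimately have "d - e \<le> inf a c"
    by simp
  then have "d \<le> e + inf a c"
    by (simp only: diff_le_eq add.commute)
  then show ?thesis
    unfolding d_def e_def .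
qed

lemma inf_abs_nonneg: "0 \<le> inf \<bar>x\<bar> \<bar>y::'a::vector_lattice\<bar>"
  by simp

lemma perp_add:
  fixes x y z :: "'a::vector_lattice"
  assumes "x \<perp> y" "x \<perp> z"
  shows "x \<perp> (y + z)"
proof -
  have "inf \<bar>x\<bar> \<bar>y + z\<bar> \<le> inf \<bar>x\<bar> (\<bar>y\<bar> + \<bar>z\<bar>)"
    by (rule inf_mono) (simp_all add: abs_triangle_ineq)
  also have "\<dots> \<le> inf \<bar>x\<bar> \<bar>y\<bar> + inf \<bar>x\<bar> \<bar>z\<bar>"
    by (rule inf_add_le) simp_all
  also have "\<dots> = 0"
    using assms by (simp add: perp_def)
  finally show ?thesis
    using inf_abs_nonneg[of x "y + z"] unfolding perp_def by (rule antisym)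
qed

lemma perp_mono:
  fixes x x' y :: "'a::vector_lattice"
  assumes "x' \<perp> y" "\<bar>x\<bar> \<le> \<bar>x'\<bar>"
  shows "x \<perp> y"
proof -
  have "inf \<bar>x\<bar> \<bar>y\<bar> \<le> inf \<bar>x'\<bar> \<bar>y\<bar>"
    using assms(2) by (intro inf_mono) simp_all
  then show ?thesis
    using assms(1) inf_abs_nonneg[of x y] unfolding perp_def by (metis antisym)
qed

lemma fragment_refl: "x \<sqsubseteq> (x::'a::vector_lattice)"
  by (simp add: fragment_def perp_def inf_absorb2)

lemma fragment_abs_le:
  fixes x y :: "'a::vector_lattice"
  assumes "x \<sqsubseteq> y"
  shows "\<bar>x\<bar> \<le> \<bar>y\<bar>"
proof -
  have "\<bar>x\<bar> \<le> \<bar>y\<bar> + \<bar>y - x\<bar>"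
    using abs_triangle_ineq4[of y "y - x"] by simp
  then have "\<bar>x\<bar> = inf \<bar>x\<bar> (\<bar>y\<bar> + \<bar>y - x\<bar>)"
    by (simp add: inf_absorb1)
  also have "\<dots> \<le> inf \<bar>x\<bar> \<bar>y\<bar> + inf \<bar>x\<bar> \<bar>y - x\<bar>"
    by (rule inf_add_le) simp_all
  also have "\<dots> = inf \<bar>x\<bar> \<bar>y\<bar>"
    using assms by (simp add: fragment_def perp_def)
  finally show ?thesis
    by simp
qed

lemma fragment_trans:
  fixes x y z :: "'a::vector_lattice"
  assumes "x \<sqsubseteq> y" "y \<sqsubseteq> z"
  shows "x \<sqsubseteq> z"
proof -
  have "x \<perp> (z - y)"
    using assms(2) fragment_abs_le[OF assms(1)] unfolding fragment_def by (rule perp_mono)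
  with assms(1) have "x \<perp> ((y - x) + (z - y))"
    unfolding fragment_def by (rule perp_add)
  then show ?thesis
    by (simp add: fragment_def)
qed

lemma fragment_abs_diff_le:
  fixes x y z :: "'a::vector_lattice"
  assumes "x \<sqsubseteq> y" "y \<sqsubseteq> z"
  shows "\<bar>y - z\<bar> \<le> \<bar>x - z\<bar>"
proof -
  have *: "(z - y) \<perp> y"
    using assms(2) by (simp add: fragment_def perp_def inf_commute)
  have "x \<perp> (z - y)"
    using assms(2) fragment_abs_le[OF assms(1)] unfolding fragment_def by (rule perp_mono)
  then have "(z - y) \<perp> - x"
    by (simp add: perp_def inf_commute)
  with * have "(z - y) \<perp> (y + - x)"
    by (rule perp_add)
  then have "(z - y) \<sqsubseteq> (z - x)"
    by (simp add: fragment_def)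
  then show ?thesis
    using fragment_abs_le abs_minus_commute by metis
qed

text \<open>Lateral continuity for nets over an arbitrary type of indices: replace the net by the set of
  its values, indexed by itself and directed by \<open>\<sqsubseteq>\<close>.\<close>

theorem laterally_continuousD:
  fixes T :: "'a::vector_lattice \<Rightarrow> 'b::vector_lattice"
    and I :: "'i set"
  assumes T: "laterally_continuous T"
    and dir: "directed_set I le"
    and conv: "laterally_converges I le x l"
  shows "order_converges I le (\<lambda>i. T (x i)) (T l)"
proof -
  have mono: "x i \<sqsubseteq> x j" if "i \<in> I" "j \<in> I" "le i j" for i j
    using conv that fragment_refl[of "x i"] unfolding laterally_converges_def by blast
  have frag: "x i \<sqsubseteq> l" if "i \<in> I" for i
    using conv that unfolding laterally_converges_def by blast
  obtain u where u: "isGlb UNIV (u ` I) 0" "\<And>i. i \<in> I \<Longrightarrow> \<bar>x i - l\<bar> \<le> u i"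
    using conv unfolding laterally_converges_def order_converges_def decreases_to_zero_def by blast
  let ?D = "x ` I"
  have dirD: "directed_set ?D (\<sqsubseteq>)"
    unfolding directed_set_def
  proof (intro conjI ballI)
    show "?D \<noteq> {}"
      using dir by (simp add: directed_set_def)
    show "reflp_on ?D (\<sqsubseteq>)"
      by (simp add: reflp_on_def fragment_refl)
    show "transp_on ?D (\<sqsubseteq>)"
      unfolding transp_on_def using fragment_trans by blast
    fix a b assume "a \<in> ?D" "b \<in> ?D"
    then obtain i j where ij: "i \<in> I" "j \<in> I" "a = x i" "b = x j"
      by blast
    then obtain k where "k \<in> I" "le i k" "le j k"
      using dir unfolding directed_set_def by blast
    with ij show "\<exists>c\<in>?D. a \<sqsubseteq> c \<and> b \<sqsubseteq> c"
      using mono by blast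
  qed
  have "decreases_to_zero ?D (\<sqsubseteq>) (\<lambda>d. \<bar>d - l\<bar>)"
    unfolding decreases_to_zero_def
  proof (intro conjI ballI impI)
    fix a b assume "a \<in> ?D" "b \<in> ?D" "a \<sqsubseteq> b"
    then show "\<bar>b - l\<bar> \<le> \<bar>a - l\<bar>"
      using frag by (blast intro: fragment_abs_diff_le)
  next
    show "isGlb UNIV ((\<lambda>d. \<bar>d - l\<bar>) ` ?D) 0"
      unfolding isGlb_def greatestP_def isLb_def setle_def setge_def
    proof (intro conjI ballI)
      fix w assume "w \<in> Collect (\<lambda>w. (\<forall>y\<in>(\<lambda>d. \<bar>d - l\<bar>) ` ?D. w \<le> y) \<and> w \<in> UNIV)"
      then have "w \<le> u i" if "i \<in> I" for i
        using u(2)[OF that] that by (auto intro: order_trans)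
      then show "w \<le> 0"
        using u(1) unfolding isGlb_def greatestP_def isLb_def setle_def setge_def by blast
    qed auto
  qed
  then have "laterally_converges ?D (\<sqsubseteq>) (\<lambda>d. d) l"
    using frag unfolding laterally_converges_def order_converges_def by blast
  then have "order_converges ?D (\<sqsubseteq>) T (T l)"
    using T dirD unfolding laterally_continuous_def by blast
  then obtain v where v: "decreases_to_zero ?D (\<sqsubseteq>) v" "\<forall>d\<in>?D. \<bar>T d - T l\<bar> \<le> v d"
    unfolding order_converges_def by blast
  then have "decreases_to_zero I le (\<lambda>i. v (x i))"
    using mono unfolding decreases_to_zero_def by (auto simp: image_image)
  then show ?thesis
    using v(2) unfolding order_converges_def by blast
qed

section \<open>Abstract Uryson operators\<close>

definition orthogonally_additive :: "('a::vector_lattice \<Rightarrow> 'b::vector_lattice) \<Rightarrow> bool" where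
  "orthogonally_additive T \<longleftrightarrow> (\<forall>x y. x \<perp> y \<longrightarrow> T (x + y) = T x + T y)"

definition order_bounded :: "'a::vector_lattice set \<Rightarrow> bool" where
  "order_bounded A \<longleftrightarrow> bdd_below A \<and> bdd_above A"

definition uryson_operators :: "('a::vector_lattice \<Rightarrow> 'b::vector_lattice) set" where
  "uryson_operators =
     {T. orthogonally_additive T \<and> (\<forall>A. order_bounded A \<longrightarrow> order_bounded (T ` A))}"

text \<open>The order of \<open>uryson_operators\<close> is the pointwise order \<open>(\<le>)\<close> of functions. Suprema in
  \<open>uryson_operators\<close> are in general not pointwise; in particular, the modulus below is
  \<open>sup T (- T)\<close> computed in \<open>uryson_operators\<close>, not \<open>\<lambda>x. \<bar>T x\<bar>\<close>.\<close>

definition uryson_modulus ::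
  "('a::vector_lattice \<Rightarrow> 'b::dedekind_complete_vector_lattice) \<Rightarrow> 'a \<Rightarrow> 'b" where
  "uryson_modulus T = (THE M. isLub uryson_operators {T, \<lambda>x. - T x} M)"

definition positive_operator :: "('a::vector_lattice \<Rightarrow> 'b::vector_lattice) \<Rightarrow> bool" where
  "positive_operator T \<longleftrightarrow> (\<forall>x. 0 \<le> T x)"

definition disjointness_preserving :: "('a::vector_lattice \<Rightarrow> 'b::vector_lattice) \<Rightarrow> bool" where
  "disjointness_preserving T \<longleftrightarrow> (\<forall>x y. x \<perp> y \<longrightarrow> T x \<perp> T y)"

lemma uryson_modulus_positive:
  assumes "T \<in> uryson_operators" "positive_operator T"
  shows "uryson_modulus T = T"
  unfolding uryson_modulus_def
proof (rule the_equality)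
  have le: "(\<lambda>x. - T x) \<le> T"
  proof (rule le_funI)
    fix x
    have "0 \<le> T x"
      using assms(2) by (simp add: positive_operator_def)
    then show "- T x \<le> T x"
      by (meson neg_le_0_iff_le order_trans)
  qed
  then show *: "isLub uryson_operators {T, \<lambda>x. - T x} T"
    using assms(1) unfolding isLub_def leastP_def isUb_def setle_def setge_def by auto
  fix M assume "isLub uryson_operators {T, \<lambda>x. - T x} M"
  with * show "M = T"
    unfolding isLub_def leastP_def isUb_def setle_def setge_def by (auto intro: antisym)
qed

section \<open>Narrowness\<close>

definition lambda_fun ::
  "('a::vector_lattice \<Rightarrow> 'b::dedekind_complete_vector_lattice) \<Rightarrow> 'a \<Rightarrow> 'b" where
  "lambda_fun T x = (INF \<pi>\<in>fragment_partitions x. SUP y\<in>\<pi>. \<bar>T y\<bar>)"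

definition lambda_narrow ::
  "('a::vector_lattice \<Rightarrow> 'b::dedekind_complete_vector_lattice) \<Rightarrow> bool" where
  "lambda_narrow T \<longleftrightarrow> (\<forall>x. lambda_fun T x = 0)"

definition pseudo_narrow ::
  "('a::vector_lattice \<Rightarrow> 'b::dedekind_complete_vector_lattice) \<Rightarrow> bool" where
  "pseudo_narrow T \<longleftrightarrow>
     (\<nexists>S. S \<in> uryson_operators \<and> disjointness_preserving S \<and>
          positive_operator S \<and> S \<noteq> (\<lambda>x. 0) \<and> S \<le> uryson_modulus T)"

end

theory Submission
  imports Defs
begin

text \<open>
  If \<open>S\<close> is positive and disjointness preserving with \<open>S \<le> T\<close>, then \<open>S x\<close> is the supremum of
  \<open>S\<close> over every disjoint partition of \<open>x\<close>, so \<open>S x \<le> lambda_fun T x\<close>. Conversely, every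
  value \<open>f = lambda_fun T w\<close> is attained at \<open>w\<close> by such an \<open>S\<close>. Indeed \<open>lambda_fun T\<close> is
  maxitive on disjoint sums; sending \<open>u\<close> to the largest component of \<open>f\<close> on which
  \<open>f \<le> lambda_fun T u\<close> gives a maxitive map \<open>R \<le> T\<close> into the Boolean algebra of components of
  \<open>f\<close> with \<open>R w = f\<close>. By Zorn's lemma there is a minimal such \<open>R\<close>. As in Monteiro's proof of
  the Boolean Hahn-Banach theorem, minimality forces \<open>R\<close> to preserve disjointness, and then it
  is orthogonally additive.
\<close>

declare neg_inf_eq_sup [simp del] neg_sup_eq_inf [simp del]
  diff_inf_eq_sup [simp del] diff_sup_eq_inf [simp del]

section \<open>Disjointness in lattice-ordered groups\<close>

lemma sup_eq_add_of_inf_eq_0: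
  fixes a b :: "'a::lattice_ab_group_add"
  assumes "inf a b = 0"
  shows "sup a b = a + b"
  using add_eq_inf_sup[of a b] assms by simp

text \<open>The identity \<open>x + c = inf x c + sup x c\<close> turns a bound on
  \<open>inf c x\<close> into one on \<open>x\<close>. Used for \<open>a\<close> and
  \<open>b\<close> it bounds \<open>sup a b\<close>; used for \<open>sup a b\<close> it turns that
  bound back.\<close>

lemma inf_sup_distrib_group:
  fixes a b c :: "'a::lattice_ab_group_add"
  shows "inf c (sup a b) = sup (inf c a) (inf c b)"
proof (rule antisym)
  define d where "d = sup (inf c a) (inf c b)"
  have bound: "x \<le> d - c + sup (sup a b) c" if x: "inf c x \<le> d" "x \<le> sup a b" for x
  proof -
    have "x = inf c x - c + sup x c"
      using add_eq_inf_sup[of x c] by (simp only: inf_commute) (simp add: algebra_simps)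
    also have "\<dots> \<le> d - c + sup (sup a b) c"
      by (intro add_mono diff_mono sup_mono x order_refl)
    finally show ?thesis .
  qed
  have "sup a b \<le> d - c + sup (sup a b) c"
    by (intro le_supI bound) (simp_all add: d_def)
  then have "sup a b + c - sup (sup a b) c \<le> d"
    by (simp only: algebra_simps)
  then show "inf c (sup a b) \<le> sup (inf c a) (inf c b)"
    using add_eq_inf_sup[of "sup a b" c] unfolding d_def by (simp only: inf_commute) simp
qed (auto intro: le_infI2)

lemma sup_inf_distrib_group:
  fixes a b c :: "'a::lattice_ab_group_add"
  shows "sup c (inf a b) = inf (sup c a) (sup c b)"
  by (rule distrib_imp1) (rule inf_sup_distrib_group)

text \<open>Raising \<open>Inf A\<close> to \<open>a\<close> raises the join with \<open>b\<close>
  by at most \<open>a - Inf A\<close>. So \<open>Inf A + x - sup (Inf A) b\<close> is a lower bound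
  of \<open>A\<close>, hence at most \<open>Inf A\<close>.\<close>

lemma le_sup_cInf:
  fixes x b :: "'a::dedekind_complete_vector_lattice"
  assumes "A \<noteq> {}" "bdd_below A" "\<And>a. a \<in> A \<Longrightarrow> x \<le> sup a b"
  shows "x \<le> sup (Inf A) b"
proof -
  let ?m = "Inf A"
  have "?m + x - sup ?m b \<le> a" if "a \<in> A" for a
  proof -
    have "?m \<le> a"
      using that assms(2) by (rule cInf_lower)
    then have "sup a b \<le> sup ?m b + (a - ?m)"
      by (intro le_supI) (metis add_le_cancel_right add.commute sup_ge1 diff_add_cancel,
          metis add_increasing2 diff_ge_0_iff_ge sup_ge2)
    then have "x \<le> sup ?m b + (a - ?m)"
      using assms(3)[OF that] by (rule order_trans[rotated])
    then show ?thesis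
      by (simp add: algebra_simps)
  qed
  then have "?m + x - sup ?m b \<le> ?m"
    by (rule cInf_greatest[OF assms(1)])
  then show ?thesis
    by (simp add: algebra_simps)
qed

text \<open>The meet \<open>e\<close> of \<open>Sup D\<close> and \<open>h\<close> is disjoint from
  each \<open>g\<close> in \<open>D\<close>, so \<open>g + e = sup g e \<le> Sup D\<close>. Thus
  \<open>Sup D - e\<close> is still an upper bound of \<open>D\<close>, which forces
  \<open>e \<le> 0\<close>.\<close>

lemma inf_cSup_eq_0:
  fixes h :: "'a::dedekind_complete_vector_lattice"
  assumes "D \<noteq> {}" "bdd_above D" and disj: "\<And>g. g \<in> D \<Longrightarrow> inf g h = 0"
  shows "inf (Sup D) h = 0"
proof (rule antisym)
  let ?e = "inf (Sup D) h"
  obtain g0 where g0: "g0 \<in> D"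
    using assms(1) by blast
  have "0 \<le> g0" "0 \<le> h"
    using disj[OF g0] by (metis inf_le1, metis inf_le2)
  moreover have "g0 \<le> Sup D"
    using g0 assms(2) by (rule cSup_upper)
  ultimately show "0 \<le> ?e"
    by simp
  have "g \<le> Sup D - ?e" if "g \<in> D" for g
  proof -
    have g: "g \<le> Sup D" "0 \<le> g"
      using that assms(2) disj[OF that] by (auto intro: cSup_upper) (metis inf_le1)
    have "inf g ?e \<le> inf g h"
      by (simp add: le_infI2)
    then have "inf g ?e = 0"
      using disj[OF that] g \<open>0 \<le> ?e\<close> by (intro antisym) simp_all
    then have "g + ?e = sup g ?e"
      by (simp add: sup_eq_add_of_inf_eq_0)
    also have "\<dots> \<le> Sup D"
      using g by simp
    finally show ?thesis
      by (simp only: le_diff_eq)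
  qed
  then have "Sup D \<le> Sup D - ?e"
    by (rule cSup_least[OF assms(1)])
  then show "?e \<le> 0"
    by (simp only: le_diff_eq) simp
qed

text \<open>Write \<open>u + v = p - n\<close>, with \<open>p\<close> and \<open>n\<close> the sums
  of the positive and of the negative parts. Disjointness gives \<open>inf p n = 0\<close>, so
  adding \<open>n\<close> to \<open>pprt (u + v)\<close> yields
  \<open>sup p n = p + n\<close>.\<close>

lemma pprt_add_disjoint:
  fixes u v :: "'a::vector_lattice"
  assumes "u \<perp> v"
  shows "pprt (u + v) = pprt u + pprt v"
proof -
  let ?p = "pprt u + pprt v" and ?n = "pprt (- u) + pprt (- v)"
  have le: "pprt x \<le> \<bar>x\<bar>" for x :: 'a
    by (simp add: pprt_def abs_ge_self)
  have uv: "inf (pprt u) (pprt (- v)) \<le> 0" "inf (pprt v) (pprt (- u)) \<le> 0"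
    using assms inf_mono[OF le[of u] le[of "- v"]] inf_mono[OF le[of "- u"] le[of v]]
    by (simp_all add: perp_def inf_commute)
  have self: "inf (pprt x) (pprt (- x)) \<le> 0" for x :: 'a
  proof -
    have "inf x (- x) = - \<bar>x\<bar>"
      by (simp add: abs_lattice neg_sup_eq_inf inf_commute)
    then have "sup 0 (inf x (- x)) = 0"
      by (simp add: sup_absorb1)
    then show ?thesis
      by (simp add: pprt_def sup_commute flip: sup_inf_distrib_group)
  qed
  have "inf ?p ?n \<le> inf ?p (pprt (- u)) + inf ?p (pprt (- v))"
    by (intro inf_add_le) simp_all
  also have "\<dots> \<le> (inf (pprt (- u)) (pprt u) + inf (pprt (- u)) (pprt v))
      + (inf (pprt (- v)) (pprt u) + inf (pprt (- v)) (pprt v))"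
    unfolding inf_commute[of ?p] by (intro add_mono inf_add_le) simp_all
  also have "\<dots> \<le> 0"
    using uv self[of u] self[of v] by (simp add: inf_commute add_nonpos_nonpos)
  finally have "inf ?p ?n = 0"
    by (intro antisym) simp_all
  then have sup: "sup ?p ?n = ?p + ?n"
    by (rule sup_eq_add_of_inf_eq_0)
  have "u + v = (pprt u + nprt u) + (pprt v + nprt v)"
    by (rule arg_cong2[OF prts prts])
  then have "u + v = ?p - ?n"
    by (simp add: pprt_neg)
  then have "pprt (u + v) + ?n = sup ?p ?n"
    unfolding pprt_def by (simp add: add_sup_distrib_right)
  then show ?thesis
    using sup by simp
qed

section \<open>Fragments\<close>

lemma perp_commute: "x \<perp> y \<longleftrightarrow> y \<perp> (x::'a::vector_lattice)"
  by (simp add: perp_def inf_commute)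

lemma perp_self_iff: "x \<perp> x \<longleftrightarrow> x = (0::'a::vector_lattice)"
  by (simp add: perp_def)

lemma perp_zero: "x \<perp> (0::'a::vector_lattice)"
  by (simp add: perp_def inf_absorb2)

lemma perp_if_abs_le:
  fixes u v x y :: "'a::vector_lattice"
  assumes "u \<perp> v" "\<bar>x\<bar> \<le> \<bar>u\<bar>" "\<bar>y\<bar> \<le> \<bar>v\<bar>"
  shows "x \<perp> y"
  using assms perp_mono perp_commute by blast

lemma fragment_add: "u \<perp> v \<Longrightarrow> u \<sqsubseteq> u + (v::'a::vector_lattice)"
  by (simp add: fragment_def)

lemma perp_sum:
  fixes x :: "'a::vector_lattice"
  assumes "\<And>y. y \<in> A \<Longrightarrow> x \<perp> y"
  shows "x \<perp> \<Sum>A"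
  using assms by (induction A rule: infinite_finite_induct) (auto simp: perp_zero intro: perp_add)

text \<open>A signed form of Riesz refinement: if \<open>u + v = z + t\<close> with both sums
  disjoint, the four signed meets of \<open>u\<close>, \<open>v\<close> with \<open>z\<close>,
  \<open>t\<close> are the entries of a common refinement.\<close>

definition signed_meet :: "'a::vector_lattice \<Rightarrow> 'a \<Rightarrow> 'a" where
  "signed_meet x y = inf (pprt x) (pprt y) - inf (pprt (- x)) (pprt (- y))"

lemma signed_meet_commute: "signed_meet x y = signed_meet y x"
  by (simp add: signed_meet_def inf_commute)

lemma abs_signed_meet_le: "\<bar>signed_meet x y\<bar> \<le> \<bar>x\<bar>"
proof -
  have "\<bar>signed_meet x y\<bar> \<le> inf (pprt x) (pprt y) + inf (pprt (- x)) (pprt (- y))"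
    unfolding signed_meet_def
    using abs_triangle_ineq4[of "inf (pprt x) (pprt y)" "inf (pprt (- x)) (pprt (- y))"]
    by (simp only: abs_of_nonneg inf.bounded_iff zero_le_pprt simp_thms)
  also have "\<dots> \<le> pprt x + pprt (- x)"
    by (intro add_mono inf_le1)
  also have "\<dots> = \<bar>x\<bar>"
    by (simp add: abs_prts pprt_neg)
  finally show ?thesis .
qed

text \<open>Positive parts add on disjoint sums, so \<open>pprt z \<le> pprt u + pprt v\<close>, and
  \<open>inf_add_le\<close> splits this bound. The two resulting meets are disjoint, so their sum is
  a join and stays below \<open>pprt z\<close>. Negative parts follow by changing all signs.\<close>

lemma signed_meet_decomp:
  fixes u v z t :: "'a::vector_lattice"
  assumes uv: "u \<perp> v" and zt: "z \<perp> t" and eq: "z + t = u + v"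
  shows "z = signed_meet z u + signed_meet z v"
proof -
  have pos: "pprt z = inf (pprt z) (pprt u) + inf (pprt z) (pprt v)"
    if uv: "u \<perp> v" and zt: "z \<perp> t" and eq: "z + t = u + v" for u v z t :: 'a
  proof (rule antisym)
    have "pprt z + pprt t = pprt u + pprt v"
      using pprt_add_disjoint[OF uv] pprt_add_disjoint[OF zt] eq by simp
    then have "pprt z \<le> pprt u + pprt v"
      by (metis add_increasing2 order_refl zero_le_pprt)
    then have "pprt z = inf (pprt z) (pprt u + pprt v)"
      by (simp add: inf_absorb1)
    also have "\<dots> \<le> inf (pprt z) (pprt u) + inf (pprt z) (pprt v)"
      by (intro inf_add_le) simp_all
    finally show "pprt z \<le> \<dots>" .
    have le: "pprt x \<le> \<bar>x\<bar>" for x :: 'a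
      by (simp add: pprt_def abs_ge_self)
    let ?a = "inf (pprt z) (pprt u)" and ?b = "inf (pprt z) (pprt v)"
    have "inf ?a ?b \<le> inf \<bar>u\<bar> \<bar>v\<bar>"
      by (intro inf_mono) (meson inf_le2 le order_trans)+
    then have "inf ?a ?b \<le> 0"
      using uv by (simp only: perp_def)
    then have "inf ?a ?b = 0"
      by (intro antisym) simp_all
    then have "?a + ?b = sup ?a ?b"
      by (simp add: sup_eq_add_of_inf_eq_0)
    also have "\<dots> \<le> pprt z"
      by simp
    finally show "?a + ?b \<le> pprt z" .
  qed
  have neg: "- u \<perp> - v" "- z \<perp> - t" "- z + - t = - u + - v"
    using uv zt arg_cong[OF eq, of uminus] by (simp_all add: perp_def)
  have "z = pprt z - pprt (- z)"
    using prts[of z] by (simp only: pprt_neg diff_minus_eq_add)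
  also have "\<dots> = signed_meet z u + signed_meet z v"
    unfolding signed_meet_def
    by (rule trans[OF arg_cong2[where f = minus, OF pos[OF uv zt eq] pos[OF neg]]]) simp
  finally show ?thesis .
qed

text \<open>The parts of \<open>z\<close> are its signed meets with \<open>u\<close> and
  \<open>v\<close>. Decomposing \<open>u\<close> and \<open>v\<close> in turn against
  \<open>z + t\<close>, where \<open>t = u + v - z\<close>, shows that these parts are fragments of
  \<open>u\<close> and \<open>v\<close>.\<close>

lemma fragment_decomp:
  fixes u v z :: "'a::vector_lattice"
  assumes uv: "u \<perp> v" and z: "z \<sqsubseteq> u + v"
  obtains z1 z2 where "z = z1 + z2" "z1 \<perp> z2" "z1 \<sqsubseteq> u" "z2 \<sqsubseteq> v" "z1 \<sqsubseteq> z" "z2 \<sqsubseteq> z"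
proof -
  define t where "t = u + v - z"
  have zt: "z \<perp> t" "z + t = u + v" "t + z = u + v" "t \<perp> z"
    using z by (simp_all add: t_def fragment_def perp_commute)
  have vu: "v \<perp> u" "v + u = z + t"
    using uv zt by (simp_all add: perp_commute add.commute)
  let ?m = signed_meet
  have le: "\<bar>?m x y\<bar> \<le> \<bar>x\<bar>" "\<bar>?m x y\<bar> \<le> \<bar>y\<bar>" for x y :: 'a
    using abs_signed_meet_le signed_meet_commute by metis+
  have dec: "z = ?m z u + ?m z v" "u = ?m u z + ?m u t" "v = ?m v z + ?m v t"
    using signed_meet_decomp[OF uv zt(1,2)] signed_meet_decomp[OF zt(1) uv]
      signed_meet_decomp[OF zt(1) vu] zt(2) by simp_all
  have perp: "?m z u \<perp> ?m z v"
    by (rule perp_if_abs_le[OF uv le(2) le(2)])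
  show ?thesis
  proof
    show "z = ?m z u + ?m z v"
      by (fact dec)
    show "?m z u \<perp> ?m z v"
      by (fact perp)
    have "?m u z \<sqsubseteq> ?m u z + ?m u t"
      by (intro fragment_add perp_if_abs_le[OF zt(1)] le)
    then show "?m z u \<sqsubseteq> u"
      using dec(2) by (simp add: signed_meet_commute)
    have "?m v z \<sqsubseteq> ?m v z + ?m v t"
      by (intro fragment_add perp_if_abs_le[OF zt(1)] le)
    then show "?m z v \<sqsubseteq> v"
      using dec(3) by (simp add: signed_meet_commute)
    show "?m z u \<sqsubseteq> z"
      using fragment_add[OF perp] dec(1) by simp
    show "?m z v \<sqsubseteq> z"
      using fragment_add[of "?m z v" "?m z u"] perp dec(1)
      by (simp add: perp_commute add.commute)
  qed
qed

lemma fragment_zero: "0 \<sqsubseteq> (x::'a::vector_lattice)"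
  by (simp add: fragment_def perp_def inf_absorb1)

lemma fragment_zero_iff: "x \<sqsubseteq> 0 \<longleftrightarrow> x = (0::'a::vector_lattice)"
  by (simp add: fragment_def perp_def)

lemma fragment_eq_0_of_perp:
  fixes z a v :: "'a::vector_lattice"
  assumes "z \<sqsubseteq> a" "z \<sqsubseteq> v" "a \<perp> v"
  shows "z = 0"
  using perp_if_abs_le[OF assms(3) fragment_abs_le[OF assms(1)] fragment_abs_le[OF assms(2)]]
  by (simp only: perp_self_iff)

section \<open>Orthogonally additive maps\<close>

lemma orthogonally_additive_zero:
  fixes T :: "'a::vector_lattice \<Rightarrow> 'b::vector_lattice"
  assumes "orthogonally_additive T"
  shows "T 0 = 0"
  using assms perp_zero[of 0] unfolding orthogonally_additive_def
  by (metis add_0 add_left_cancel add.right_neutral)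

lemma positive_operator_fragment_mono:
  fixes T :: "'a::vector_lattice \<Rightarrow> 'b::vector_lattice"
  assumes T: "orthogonally_additive T" "positive_operator T" and "x \<sqsubseteq> y"
  shows "T x \<le> T y"
proof -
  have "T (x + (y - x)) = T x + T (y - x)"
    using T(1) \<open>x \<sqsubseteq> y\<close> unfolding orthogonally_additive_def fragment_def by blast
  then show ?thesis
    using T(2) by (simp add: positive_operator_def)
qed

text \<open>For positive \<open>T\<close>, the value \<open>lambda_fun T x\<close> is the infimum of all \<open>b \<ge> 0\<close> with
  \<open>x \<in> fine_elements T b\<close>.\<close>

inductive_set fine_elements :: "('a::vector_lattice \<Rightarrow> 'b::vector_lattice) \<Rightarrow> 'b \<Rightarrow> 'a set"
  for T :: "'a \<Rightarrow> 'b" and b :: 'b where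
  zero: "0 \<in> fine_elements T b"
| add: "c \<perp> s \<Longrightarrow> T c \<le> b \<Longrightarrow> s \<in> fine_elements T b \<Longrightarrow> c + s \<in> fine_elements T b"

lemma fine_elements_mono:
  assumes "s \<in> fine_elements T b" "b \<le> b'"
  shows "s \<in> fine_elements T b'"
  using assms by (induction) (auto intro: fine_elements.intros order_trans)

lemma fine_elementsI:
  assumes "T x \<le> b"
  shows "x \<in> fine_elements T b"
  using fine_elements.add[of x 0 T b] assms by (simp add: perp_zero fine_elements.zero)

lemma fine_elements_fragment:
  assumes T: "orthogonally_additive T" "positive_operator T"
    and "s \<in> fine_elements T b" "u \<sqsubseteq> s"
  shows "u \<in> fine_elements T b"
  using assms(3,4)
proof (induction arbitrary: u)
  case zero
  then show ?case
    by (simp add: fragment_zero_iff fine_elements.zero)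
next
  case (add c s)
  obtain u1 u2 where u: "u = u1 + u2" "u1 \<perp> u2" "u1 \<sqsubseteq> c" "u2 \<sqsubseteq> s"
    using fragment_decomp[OF add.hyps(1) add.prems] by blast
  have "T u1 \<le> b"
    using positive_operator_fragment_mono[OF T u(3)] add.hyps(2) by (rule order_trans)
  then show ?case
    unfolding u(1) by (rule fine_elements.add[OF u(2) _ add.IH[OF u(4)]])
qed

lemma fine_elements_disjoint_add:
  assumes "u \<in> fine_elements T b" "v \<in> fine_elements T b" "u \<perp> v"
  shows "u + v \<in> fine_elements T b"
  using assms(1,3)
proof induction
  case zero
  then show ?case
    using assms(2) by simp
next
  case (add c s)
  have "c \<sqsubseteq> c + s" "s \<sqsubseteq> c + s"
    using add.hyps(1) fragment_add[of c s] fragment_add[of s c]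
    by (simp_all add: perp_commute add.commute)
  then have "c \<perp> v" "s \<perp> v"
    using add.prems fragment_abs_le perp_mono by blast+
  then have "c + (s + v) \<in> fine_elements T b"
    using add.hyps add.IH by (blast intro: fine_elements.add perp_add)
  then show ?case
    by (simp add: add.assoc)
qed

lemma fine_elements_partition:
  fixes T :: "'a::vector_lattice \<Rightarrow> 'b::vector_lattice"
  assumes "T 0 \<le> b" "s \<in> fine_elements T b"
  shows "\<exists>\<pi>\<in>fragment_partitions s. \<forall>y\<in>\<pi>. T y \<le> b"
  using assms(2)
proof induction
  case zero
  \<comment> \<open>Partitions are nonempty, so \<open>0\<close> is partitioned by
    \<open>{0}\<close>; this is where \<open>T 0 \<le> b\<close> enters.\<close>
  show ?case
    using assms(1)
    by (intro bexI[of _ "{0}"]) (simp_all add: fragment_partitions_def fragments_def fragment_refl)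
next
  case (add c s)
  then obtain \<pi> where \<pi>: "\<pi> \<in> fragment_partitions s" "\<And>y. y \<in> \<pi> \<Longrightarrow> T y \<le> b"
    by blast
  then have sum: "s = \<Sum>\<pi>" and fin: "finite \<pi>" and frag: "\<And>y. y \<in> \<pi> \<Longrightarrow> y \<sqsubseteq> s"
    and disj: "pairwise (\<perp>) \<pi>"
    by (auto simp: fragment_partitions_def fragments_def)
  have s: "s \<sqsubseteq> c + s"
    using add.hyps(1) fragment_add[of s c] by (simp add: perp_commute add.commute)
  \<comment> \<open>A partition is a set and cannot repeat \<open>c\<close>. If \<open>c\<close> is
    already a member, it is a fragment of \<open>s\<close> disjoint from \<open>s\<close>, hence
    \<open>0\<close>, and \<open>\<pi>\<close> itself serves.\<close>
  show ?case
  proof (cases "c \<in> \<pi>")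
    case True
    then have "c = 0"
      using frag add.hyps(1) fragment_eq_0_of_perp[of c c s] fragment_refl by blast
    then show ?thesis
      using \<pi> by auto
  next
    case False
    have "c \<perp> y" if "y \<in> \<pi>" for y
      using perp_if_abs_le[OF add.hyps(1) order_refl fragment_abs_le[OF frag[OF that]]] .
    then have "insert c \<pi> \<in> fragment_partitions (c + s)"
      using False fin disj sum fragment_add[OF add.hyps(1)] fragment_trans[OF frag s]
      unfolding fragment_partitions_def fragments_def
      by (auto simp: pairwise_insert perp_commute)
    then show ?thesis
      using \<pi>(2) add.hyps(2) by blast
  qed
qed

section \<open>The function \<open>lambda_fun\<close>\<close>

lemma singleton_fragment_partition: "{x} \<in> fragment_partitions x"
  by (simp add: fragment_partitions_def fragments_def fragment_refl)

lemma cSUP_abs_nonneg: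
  fixes T :: "'a::vector_lattice \<Rightarrow> 'b::dedekind_complete_vector_lattice"
  assumes "\<pi> \<in> fragment_partitions x"
  shows "0 \<le> (SUP y\<in>\<pi>. \<bar>T y\<bar>)"
proof -
  from assms obtain y where "y \<in> \<pi>" and fin: "finite \<pi>"
    by (auto simp: fragment_partitions_def)
  have "\<bar>T y\<bar> \<le> (SUP y\<in>\<pi>. \<bar>T y\<bar>)"
    using \<open>y \<in> \<pi>\<close> fin by (intro cSUP_upper bdd_above_finite) simp_all
  then show ?thesis
    by (rule order_trans[OF abs_ge_zero])
qed

lemma lambda_fun_nonneg: "0 \<le> lambda_fun T x"
  unfolding lambda_fun_def using singleton_fragment_partition
  by (intro cINF_greatest cSUP_abs_nonneg) auto

lemma lambda_fun_le:
  assumes "\<pi> \<in> fragment_partitions x" "\<And>y. y \<in> \<pi> \<Longrightarrow> \<bar>T y\<bar> \<le> b"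
  shows "lambda_fun T x \<le> b"
proof -
  have "lambda_fun T x \<le> (SUP y\<in>\<pi>. \<bar>T y\<bar>)"
    unfolding lambda_fun_def
    by (rule cINF_lower[OF _ assms(1)]) (auto intro!: bdd_belowI2[where m = 0] cSUP_abs_nonneg)
  also have "\<dots> \<le> b"
    using assms by (intro cSUP_least) (auto simp: fragment_partitions_def)
  finally show ?thesis .
qed

lemma lambda_fun_le_if_fine:
  assumes T: "orthogonally_additive T" "positive_operator T"
    and "0 \<le> b" "x \<in> fine_elements T b"
  shows "lambda_fun T x \<le> b"
proof -
  obtain \<pi> where "\<pi> \<in> fragment_partitions x" "\<forall>y\<in>\<pi>. T y \<le> b"
    using fine_elements_partition[of T b x] assms orthogonally_additive_zero[OF T(1)] by auto
  then show ?thesis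
    using T(2) by (intro lambda_fun_le) (auto simp: positive_operator_def)
qed

section \<open>Disjointness preserving minorants lie below \<open>lambda_fun\<close>\<close>

text \<open>The values on disjoint pieces are disjoint, so their sum is their join, and a common
  bound of the values bounds the sum. \<open>0 \<le> b\<close> covers the empty family.\<close>

lemma disjointness_preserving_le_partition:
  fixes S :: "'a::vector_lattice \<Rightarrow> 'b::vector_lattice"
  assumes S: "orthogonally_additive S" "positive_operator S" "disjointness_preserving S"
    and "finite \<pi>" "pairwise (\<perp>) \<pi>" "0 \<le> b" "\<And>y. y \<in> \<pi> \<Longrightarrow> S y \<le> b"
  shows "S (\<Sum>\<pi>) \<le> b"
  using assms(4-)
proof (induction rule: finite_induct)
  case empty
  then show ?case
    using orthogonally_additive_zero[OF S(1)] by simp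
next
  case (insert c \<pi>)
  have perp: "c \<perp> \<Sum>\<pi>"
    using insert.prems(1) insert.hyps(2) by (intro perp_sum) (auto simp: pairwise_insert)
  then have "S c \<perp> S (\<Sum>\<pi>)"
    using S(3) by (simp add: disjointness_preserving_def)
  then have "inf (S c) (S (\<Sum>\<pi>)) = 0"
    using S(2) by (simp add: perp_def positive_operator_def)
  then have "S (\<Sum>(insert c \<pi>)) = sup (S c) (S (\<Sum>\<pi>))"
    using S(1) perp insert.hyps
    by (simp add: sup_eq_add_of_inf_eq_0 orthogonally_additive_def)
  then show ?case
    using insert by (simp add: pairwise_insert)
qed

lemma disjointness_preserving_le_lambda_fun:
  fixes T :: "'a::vector_lattice \<Rightarrow> 'b::dedekind_complete_vector_lattice"
  assumes S: "orthogonally_additive S" "positive_operator S" "disjointness_preserving S"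
    and "S \<le> T"
  shows "S x \<le> lambda_fun T x"
  unfolding lambda_fun_def
proof (rule cINF_greatest)
  show "fragment_partitions x \<noteq> {}"
    using singleton_fragment_partition by blast
  fix \<pi> assume \<pi>: "\<pi> \<in> fragment_partitions x"
  have "S (\<Sum>\<pi>) \<le> (SUP y\<in>\<pi>. \<bar>T y\<bar>)"
  proof (rule disjointness_preserving_le_partition[OF S])
    show "finite \<pi>" "pairwise (\<perp>) \<pi>"
      using \<pi> by (auto simp: fragment_partitions_def)
    show "0 \<le> (SUP y\<in>\<pi>. \<bar>T y\<bar>)"
      using \<pi> by (rule cSUP_abs_nonneg)
    fix y assume "y \<in> \<pi>"
    have "S y \<le> \<bar>T y\<bar>"
      using \<open>S \<le> T\<close> abs_ge_self[of "T y"] by (auto simp: le_fun_def intro: order_trans)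
    also have "\<dots> \<le> (SUP y\<in>\<pi>. \<bar>T y\<bar>)"
      using \<open>y \<in> \<pi>\<close> \<open>finite \<pi>\<close> by (intro cSUP_upper bdd_above_finite) simp_all
    finally show "S y \<le> (SUP y\<in>\<pi>. \<bar>T y\<bar>)" .
  qed
  then show "S x \<le> (SUP y\<in>\<pi>. \<bar>T y\<bar>)"
    using \<pi> by (simp add: fragment_partitions_def)
qed

section \<open>Components of a positive element\<close>

text \<open>The equation forces \<open>0 \<le> g \<le> f\<close>. For \<open>f \<ge> 0\<close> in a
  Dedekind complete lattice these elements form a complete Boolean algebra with complement
  \<open>f - g\<close>.\<close>

definition components :: "'b::lattice_ab_group_add \<Rightarrow> 'b set" where
  "components f = {g. inf g (f - g) = 0}"

lemma components_nonneg: "g \<in> components f \<Longrightarrow> 0 \<le> g"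
  unfolding components_def using inf_le1[of g "f - g"] by simp

lemma components_le: "g \<in> components f \<Longrightarrow> g \<le> f"
  unfolding components_def using inf_le2[of g "f - g"] by simp

lemma components_compl: "g \<in> components f \<Longrightarrow> f - g \<in> components f"
  by (simp add: components_def inf_commute)

lemma bdd_above_components: "A \<subseteq> components f \<Longrightarrow> bdd_above A"
  by (rule bdd_aboveI[of _ f]) (auto dest: components_le)

lemma bdd_below_components: "A \<subseteq> components f \<Longrightarrow> bdd_below A"
  by (rule bdd_belowI[of _ 0]) (auto dest: components_nonneg)

text \<open>Each \<open>a\<close> in \<open>A\<close> is disjoint from \<open>f - a\<close>, hence
  from the smaller \<open>f - Sup A\<close>, and \<open>inf_cSup_eq_0\<close> passes this to the
  supremum.\<close>

lemma components_cSup: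
  fixes f :: "'b::dedekind_complete_vector_lattice"
  assumes "A \<noteq> {}" "A \<subseteq> components f"
  shows "Sup A \<in> components f"
  unfolding components_def
proof (intro CollectI inf_cSup_eq_0)
  have bdd: "bdd_above A"
    using assms(2) by (rule bdd_above_components)
  then show "bdd_above A" .
  show "A \<noteq> {}"
    by fact
  have "Sup A \<le> f"
    using assms components_le by (blast intro: cSup_least)
  fix a assume "a \<in> A"
  then have a: "inf a (f - a) = 0" "0 \<le> a" "a \<le> Sup A"
    using assms(2) bdd components_nonneg by (auto simp: components_def intro: cSup_upper)
  have "inf a (f - Sup A) \<le> inf a (f - a)"
    using a(3) by (intro inf_mono diff_mono order_refl)
  with a \<open>Sup A \<le> f\<close> show "inf a (f - Sup A) = 0"
    by (intro antisym) simp_all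
qed

text \<open>With \<open>e\<close> the meet to be shown zero, \<open>Inf A + e\<close> is at most
  \<open>a + a\<close> and at most \<open>f = a + (f - a)\<close>. The meet of these two is
  \<open>a + inf a (f - a) = a\<close>, so \<open>Inf A + e\<close> is a lower bound of
  \<open>A\<close>.\<close>

lemma components_cInf:
  fixes f :: "'b::dedekind_complete_vector_lattice"
  assumes "A \<noteq> {}" "A \<subseteq> components f"
  shows "Inf A \<in> components f"
  unfolding components_def
proof (intro CollectI antisym)
  let ?e = "inf (Inf A) (f - Inf A)"
  have bdd: "bdd_below A"
    using assms(2) by (rule bdd_below_components)
  obtain a0 where a0: "a0 \<in> A"
    using assms(1) by blast
  have "0 \<le> Inf A"
    using assms components_nonneg by (blast intro: cInf_greatest)
  moreover have "Inf A \<le> f"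
    using cInf_lower[OF a0 bdd] a0 assms(2) components_le by (blast intro: order_trans)
  ultimately show "0 \<le> ?e"
    by simp
  have "Inf A + ?e \<le> a" if "a \<in> A" for a
  proof -
    have a: "Inf A \<le> a" "inf a (f - a) = 0"
      using that bdd assms(2) by (auto simp: components_def intro: cInf_lower)
    have "Inf A + ?e \<le> a + a"
      using a(1) by (intro add_mono le_infI1)
    moreover have "Inf A + ?e \<le> Inf A + (f - Inf A)"
      by (intro add_mono inf_le2 order_refl)
    ultimately have "Inf A + ?e \<le> inf (a + a) (a + (f - a))"
      by simp
    also have "\<dots> = a"
      by (simp only: add_inf_distrib_left[symmetric] a(2) add_0_right)
    finally show ?thesis .
  qed
  then have "Inf A + ?e \<le> Inf A"
    by (rule cInf_greatest[OF assms(1)])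
  then show "?e \<le> 0"
    by simp
qed

lemma components_inf:
  fixes f :: "'b::dedekind_complete_vector_lattice"
  assumes "a \<in> components f" "b \<in> components f"
  shows "inf a b \<in> components f"
  using components_cInf[of "{a, b}" f] assms by (simp add: cInf_insert)

section \<open>Maxitive minorants\<close>

text \<open>Preservation of disjointness is not demanded: the function built in
  \<open>maxitive_minorants_nonempty\<close> need not have it, and minimality will provide it. On
  disjoint sums the converse inequality comes from monotonicity on fragments.\<close>

definition maxitive_minorants ::
  "('a::vector_lattice \<Rightarrow> 'b::vector_lattice) \<Rightarrow> 'b \<Rightarrow> 'a \<Rightarrow> ('a \<Rightarrow> 'b) set" where
  "maxitive_minorants T f w =
     {R. (\<forall>x. R x \<in> components f) \<and> (\<forall>x. R x \<le> T x) \<and> (\<forall>x y. x \<sqsubseteq> y \<longrightarrow> R x \<le> R y) \<and>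
         (\<forall>x y. x \<perp> y \<longrightarrow> R (x + y) \<le> sup (R x) (R y)) \<and> R w = f}"

lemma maxitive_minorantsD:
  assumes "R \<in> maxitive_minorants T f w"
  shows "R x \<in> components f" "R x \<le> T x" "x \<sqsubseteq> y \<Longrightarrow> R x \<le> R y"
    "x \<perp> y \<Longrightarrow> R (x + y) \<le> sup (R x) (R y)" "R w = f"
  using assms by (simp_all add: maxitive_minorants_def)

lemma maxitive_minorants_nonempty:
  fixes T :: "'a::vector_lattice \<Rightarrow> 'b::dedekind_complete_vector_lattice"
  assumes T: "orthogonally_additive T" "positive_operator T"
    and "0 \<le> f" and f_le: "\<And>b. 0 \<le> b \<Longrightarrow> w \<in> fine_elements T b \<Longrightarrow> f \<le> b"
  shows "maxitive_minorants T f w \<noteq> {}"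
proof -
  \<comment> \<open>\<open>inf g (pprt (f - b)) = 0\<close> expresses \<open>f \<le> b\<close> on
    the part of \<open>f\<close> under \<open>g\<close>. Requiring it for every admissible
    \<open>b\<close> encodes \<open>f \<le> lambda_fun T u\<close> there, and \<open>Q u\<close> is
    the largest such part.\<close>
  define D where "D u = {g. 0 \<le> g \<and> g \<le> f \<and>
    (\<forall>b. 0 \<le> b \<and> u \<in> fine_elements T b \<longrightarrow> inf g (pprt (f - b)) = 0)}" for u
  define Q where "Q u = Sup (D u)" for u
  have zero: "0 \<in> D u" for u
    using \<open>0 \<le> f\<close> by (simp add: D_def inf_absorb1)
  have bdd: "bdd_above (D u)" for u
    by (rule bdd_aboveI[of _ f]) (simp add: D_def)
  have Q_in: "Q u \<in> D u" for u
    unfolding D_def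
  proof (intro CollectI conjI allI impI)
    show "0 \<le> Q u"
      unfolding Q_def using zero bdd by (rule cSup_upper)
    show "Q u \<le> f"
      unfolding Q_def using zero by (intro cSup_least) (auto simp: D_def)
    show "inf (Q u) (pprt (f - b)) = 0" if "0 \<le> b \<and> u \<in> fine_elements T b" for b
      unfolding Q_def using zero bdd that by (intro inf_cSup_eq_0) (auto simp: D_def)
  qed
  then have Q: "0 \<le> Q u" "Q u \<le> f"
    and Q_inf: "\<And>b. 0 \<le> b \<Longrightarrow> u \<in> fine_elements T b \<Longrightarrow> inf (Q u) (pprt (f - b)) = 0" for u
    by (auto simp: D_def)
  have Q_upper: "g \<le> Q u" if "g \<in> D u" for g u
    unfolding Q_def using that bdd by (rule cSup_upper)
  \<comment> \<open>Adding to \<open>Q u\<close> its meet with \<open>f - Q u\<close> stays in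
    \<open>D u\<close>, so by maximality this meet is \<open>0\<close>.\<close>
  have comp: "Q u \<in> components f" for u
  proof -
    let ?e = "inf (Q u) (f - Q u)"
    have e: "0 \<le> ?e"
      using Q(1,2)[of u] by simp
    have "Q u + ?e \<in> D u"
      unfolding D_def
    proof (intro CollectI conjI allI impI)
      show "0 \<le> Q u + ?e"
        using Q(1) e by (rule add_nonneg_nonneg)
      have "Q u + ?e \<le> Q u + (f - Q u)"
        by (intro add_left_mono inf_le2)
      then show "Q u + ?e \<le> f"
        by simp
      fix b assume b: "0 \<le> b \<and> u \<in> fine_elements T b"
      let ?h = "pprt (f - b)"
      have "inf ?h (Q u + ?e) \<le> inf ?h (Q u) + inf ?h ?e"
        using Q(1) e by (intro inf_add_le) simp_all
      also have "\<dots> \<le> inf ?h (Q u) + inf ?h (Q u)"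
        by (intro add_left_mono inf_mono inf_le1 order_refl)
      also have "\<dots> = 0"
        using Q_inf[of b u] b by (simp add: inf_commute)
      finally show "inf (Q u + ?e) ?h = 0"
        using Q(1)[of u] e by (intro antisym) (simp_all add: inf_commute add_nonneg_nonneg)
    qed
    from Q_upper[OF this] e show ?thesis
      by (simp add: components_def antisym)
  qed
  \<comment> \<open>The bound \<open>b = T u\<close> is admissible, since \<open>u\<close> is its
    own one-piece decomposition. So \<open>Q u\<close> is disjoint from
    \<open>pprt (f - T u)\<close> and lies below \<open>T u\<close>.\<close>
  have le_T: "Q u \<le> T u" for u
  proof -
    have "0 \<le> T u"
      using T(2) by (simp add: positive_operator_def)
    have "f - T u \<le> pprt (f - T u)"
      by (simp add: pprt_def)
    then have "Q u \<le> pprt (f - T u) + T u"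
      unfolding diff_le_eq by (rule order_trans[OF Q(2)])
    then have "Q u = inf (Q u) (pprt (f - T u) + T u)"
      by (simp add: inf_absorb1)
    also have "\<dots> \<le> inf (Q u) (pprt (f - T u)) + inf (Q u) (T u)"
      using Q(1) \<open>0 \<le> T u\<close> by (intro inf_add_le) simp_all
    also have "\<dots> = inf (Q u) (T u)"
      using Q_inf[OF \<open>0 \<le> T u\<close> fine_elementsI[OF order_refl]] by simp
    finally show ?thesis
      by simp
  qed
  have mono: "Q x \<le> Q y" if "x \<sqsubseteq> y" for x y
  proof (rule Q_upper)
    show "Q x \<in> D y"
      using Q(1,2)[of x] Q_inf[of _ x] fine_elements_fragment[OF T _ that] by (auto simp: D_def)
  qed
  have max: "Q (x + y) \<le> sup (Q x) (Q y)" if "x \<perp> y" for x y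
  proof -
    \<comment> \<open>\<open>q\<close> is the part of \<open>Q (x + y)\<close> outside
      \<open>Q x\<close>; it has to lie below \<open>Q y\<close>.\<close>
    define q where "q = inf (Q (x + y)) (f - Q x)"
    have q0: "0 \<le> q" "q \<le> Q (x + y)" "q \<le> f - Q x"
      using Q(1,2)[of "x + y"] Q(2)[of x] by (simp_all add: q_def)
    have "q \<in> D y"
      unfolding D_def
    proof (intro CollectI conjI allI impI)
      show "0 \<le> q" "q \<le> f"
        using q0 Q(2)[of "x + y"] by (auto intro: order_trans)
      fix b assume b: "0 \<le> b \<and> y \<in> fine_elements T b"
      \<comment> \<open>\<open>e\<close> is the part of \<open>q\<close> violating the bound
        \<open>b\<close> for \<open>y\<close>. A bound \<open>a\<close> for \<open>x\<close>
        combines with \<open>b\<close> into the bound \<open>sup a b\<close> for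
        \<open>x + y\<close>, which \<open>Q (x + y)\<close> respects, so \<open>e\<close> respects
        \<open>a\<close>. Hence \<open>e\<close> is below both \<open>Q x\<close> and
        \<open>f - Q x\<close>, which are disjoint.\<close>
      define e where "e = inf q (pprt (f - b))"
      have e0: "0 \<le> e" "e \<le> q"
        using q0(1) by (simp_all add: e_def)
      have "inf e (pprt (f - a)) = 0" if a: "0 \<le> a" "x \<in> fine_elements T a" for a
      proof -
        have le: "a \<le> sup a b" "b \<le> sup a b"
          by simp_all
        have "x + y \<in> fine_elements T (sup a b)"
          using a b \<open>x \<perp> y\<close> le by (blast intro: fine_elements_disjoint_add fine_elements_mono)
        then have "inf (Q (x + y)) (pprt (f - sup a b)) = 0"
          using a(1) by (intro Q_inf) (simp add: le_supI1)
        moreover have "pprt (f - sup a b) = inf (pprt (f - a)) (pprt (f - b))"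
          by (simp add: pprt_def diff_sup_eq_inf add_inf_distrib_left sup_commute
              sup_inf_distrib_group)
        moreover have "inf e (pprt (f - a)) \<le> inf (Q (x + y)) (inf (pprt (f - a)) (pprt (f - b)))"
          using e0 q0 by (auto simp: e_def intro: le_infI1 le_infI2)
        ultimately show ?thesis
          using e0 by (intro antisym) simp_all
      qed
      then have "e \<in> D x"
        using e0 q0 Q(2)[of "x + y"] by (auto simp: D_def intro: order_trans)
      then have "e \<le> inf (Q x) (f - Q x)"
        using Q_upper e0 q0 by (auto intro: order_trans)
      also have "\<dots> = 0"
        using comp by (simp add: components_def)
      finally show "inf q (pprt (f - b)) = 0"
        using e0(1) unfolding e_def by (rule antisym)
    qed
    then have "q \<le> Q y"
      by (rule Q_upper)
    have "Q (x + y) = inf (Q (x + y)) (Q x + (f - Q x))"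
      using Q(2) by (simp add: inf_absorb1)
    also have "Q x + (f - Q x) = sup (Q x) (f - Q x)"
      using comp[of x] by (simp only: components_def sup_eq_add_of_inf_eq_0 mem_Collect_eq)
    also have "inf (Q (x + y)) \<dots> = sup (inf (Q (x + y)) (Q x)) q"
      by (simp only: inf_sup_distrib_group q_def)
    also have "\<dots> \<le> sup (Q x) (Q y)"
      using \<open>q \<le> Q y\<close> by (intro sup_mono inf_le2)
    finally show ?thesis .
  qed
  \<comment> \<open>Here \<open>pprt (f - b) = 0\<close> for every admissible \<open>b\<close>, by
    \<open>f_le\<close>.\<close>
  have "f \<in> D w"
    using \<open>0 \<le> f\<close> f_le by (auto simp: D_def inf_absorb2)
  then have "Q w = f"
    using Q_upper Q(2) by (intro antisym)
  with comp le_T mono max have "Q \<in> maxitive_minorants T f w"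
    by (simp add: maxitive_minorants_def)
  then show ?thesis
    by blast
qed

section \<open>Minimal maxitive minorants\<close>

text \<open>Zorn's lemma applies to the reversed order: a nonempty chain is bounded by its pointwise
  infimum, whose values are again components of \<open>f\<close>.\<close>

lemma maxitive_minorants_minimal:
  fixes T :: "'a::vector_lattice \<Rightarrow> 'b::dedekind_complete_vector_lattice"
  assumes "maxitive_minorants T f w \<noteq> {}"
  obtains R where "R \<in> maxitive_minorants T f w"
    "\<forall>R'\<in>maxitive_minorants T f w. R' \<le> R \<longrightarrow> R' = R"
proof -
  let ?M = "maxitive_minorants T f w"
  have "\<exists>R\<in>?M. \<forall>R'\<in>?M. R \<ge> R' \<longrightarrow> R' = R"
  proof (rule predicate_Zorn)
    show "partial_order_on ?M (relation_of (\<ge>) ?M)"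
      by (rule partial_order_on_relation_ofI) auto
    fix C assume "C \<in> Chains (relation_of (\<ge>) ?M)"
    then have C: "C \<subseteq> ?M" "\<And>R1 R2. R1 \<in> C \<Longrightarrow> R2 \<in> C \<Longrightarrow> R1 \<le> R2 \<or> R2 \<le> R1"
      by (auto simp: Chains_def relation_of_def)
    show "\<exists>U\<in>?M. \<forall>R\<in>C. R \<ge> U"
    proof (cases "C = {}")
      case True
      then show ?thesis
        using assms by blast
    next
      case False
      define U where "U x = (INF R\<in>C. R x)" for x
      have sub: "(\<lambda>R. R x) ` C \<subseteq> components f" for x
        using C(1) maxitive_minorantsD(1) by blast
      have bdd: "bdd_below ((\<lambda>R. R x) ` C)" for x
        using sub by (rule bdd_below_components)
      have le: "U x \<le> R x" if "R \<in> C" for R x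
        unfolding U_def using bdd that by (rule cINF_lower)
      obtain R0 where R0: "R0 \<in> C" "R0 \<in> ?M"
        using False C(1) by blast
      have "U \<in> ?M"
        unfolding maxitive_minorants_def
      proof (intro CollectI conjI allI impI)
        show "U x \<in> components f" for x
          unfolding U_def using False sub by (intro components_cInf) auto
        show "U x \<le> T x" for x
          using le[OF R0(1)] maxitive_minorantsD(2)[OF R0(2)] by (rule order_trans)
        show "U x \<le> U y" if "x \<sqsubseteq> y" for x y
          unfolding U_def[of y]
        proof (rule cINF_greatest[OF False])
          fix R assume "R \<in> C"
          then show "U x \<le> R y"
            using le C(1) maxitive_minorantsD(3)[OF _ that] by (blast intro: order_trans)
        qed
        show "U (x + y) \<le> sup (U x) (U y)" if "x \<perp> y" for x y
        proof -
          \<comment> \<open>Bounding by two independent members of the chain, through the smaller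
            one, lets the infima be taken one variable at a time with
            \<open>le_sup_cInf\<close>.\<close>
          have "U (x + y) \<le> sup (R1 x) (R2 y)" if R: "R1 \<in> C" "R2 \<in> C" for R1 R2
          proof -
            obtain R where "R \<in> C" "R \<le> R1" "R \<le> R2"
              using C(2)[OF R] R by auto
            have "U (x + y) \<le> R (x + y)"
              using \<open>R \<in> C\<close> by (rule le)
            also have "\<dots> \<le> sup (R x) (R y)"
              using C(1) \<open>R \<in> C\<close> \<open>x \<perp> y\<close> maxitive_minorantsD(4) by blast
            also have "\<dots> \<le> sup (R1 x) (R2 y)"
              using \<open>R \<le> R1\<close> \<open>R \<le> R2\<close> by (intro sup_mono) (simp_all add: le_fun_def)
            finally show ?thesis .
          qed
          then have "U (x + y) \<le> sup (U x) (R2 y)" if "R2 \<in> C" for R2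
            unfolding U_def[of x] using False bdd that by (intro le_sup_cInf) auto
          then have "U (x + y) \<le> sup (U y) (U x)"
            unfolding U_def[of y] using False bdd
            by (intro le_sup_cInf) (auto simp: sup_commute)
          then show ?thesis
            by (simp only: sup_commute)
        qed
        have "(\<lambda>R. R w) ` C = {f}"
          using False C(1) maxitive_minorantsD(5) by blast
        then show "U w = f"
          by (simp add: U_def)
      qed
      moreover have "\<forall>R\<in>C. R \<ge> U"
        using le by (simp add: le_fun_def)
      ultimately show ?thesis
        by blast
    qed
  qed
  then show thesis
    using that by blast
qed

text \<open>The right-hand side, as a function of \<open>y\<close>, is again a maxitive minorant below \<open>R\<close>.\<close>

lemma minimal_maxitive_minorant_eq:
  fixes R :: "'a::vector_lattice \<Rightarrow> 'b::dedekind_complete_vector_lattice"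
  assumes R: "R \<in> maxitive_minorants T f w"
    and min: "\<forall>R'\<in>maxitive_minorants T f w. R' \<le> R \<longrightarrow> R' = R"
    and "a \<sqsubseteq> w"
  shows "R y = Sup ({R z | z. z \<sqsubseteq> y \<and> z \<sqsubseteq> a} \<union> {inf (R z) (f - R a) | z. z \<sqsubseteq> y \<and> z \<sqsubseteq> w})"
proof -
  note RD = maxitive_minorantsD[OF R]
  \<comment> \<open>In Boolean terms, \<open>Sup (A y)\<close> joins \<open>R\<close> at the meet of
    \<open>y\<close> and \<open>a\<close> with the part outside \<open>R a\<close> of
    \<open>R\<close> at the meet of \<open>y\<close> and \<open>w\<close>. Suprema over common
    fragments replace these meets.\<close>
  define A where "A y = {R z | z. z \<sqsubseteq> y \<and> z \<sqsubseteq> a} \<union> {inf (R z) (f - R a) | z. z \<sqsubseteq> y \<and> z \<sqsubseteq> w}" for y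
  define R' where "R' y = Sup (A y)" for y
  have sub: "A y \<subseteq> components f" for y
    using RD(1) by (auto simp: A_def intro: components_inf components_compl)
  have ne: "A y \<noteq> {}" for y
    using fragment_zero by (auto simp: A_def)
  have upper: "g \<le> R' y" if "g \<in> A y" for g y
    unfolding R'_def using that bdd_above_components[OF sub] by (rule cSup_upper)
  have le_R: "R' y \<le> R y" for y
    unfolding R'_def
    by (rule cSup_least[OF ne]) (auto simp: A_def intro: RD(3) le_infI1)
  have "R' \<in> maxitive_minorants T f w"
    unfolding maxitive_minorants_def
  proof (intro CollectI conjI allI impI)
    show comp: "R' x \<in> components f" for x
      unfolding R'_def using ne sub by (rule components_cSup)
    show "R' x \<le> T x" for x
      using le_R RD(2) by (rule order_trans)
    show "R' x \<le> R' y" if "x \<sqsubseteq> y" for x y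
      unfolding R'_def
    proof (rule cSup_subset_mono[OF ne bdd_above_components[OF sub]])
      show "A x \<subseteq> A y"
        using that fragment_trans unfolding A_def by blast
    qed
    show "R' (x + y) \<le> sup (R' x) (R' y)" if xy: "x \<perp> y" for x y
      unfolding R'_def[of "x + y"]
    proof (rule cSup_least[OF ne])
      fix g assume "g \<in> A (x + y)"
      then consider z where "g = R z" "z \<sqsubseteq> x + y" "z \<sqsubseteq> a"
        | z where "g = inf (R z) (f - R a)" "z \<sqsubseteq> x + y" "z \<sqsubseteq> w"
        by (auto simp: A_def)
      then show "g \<le> sup (R' x) (R' y)"
      proof cases
        case 1
        obtain z1 z2 where z: "z = z1 + z2" "z1 \<perp> z2" "z1 \<sqsubseteq> x" "z2 \<sqsubseteq> y" "z1 \<sqsubseteq> z" "z2 \<sqsubseteq> z"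
          using fragment_decomp[OF xy 1(2)] .
        have "R z1 \<in> A x" "R z2 \<in> A y"
          using z 1(3) fragment_trans unfolding A_def by blast+
        then show ?thesis
          using RD(4)[OF z(2)] sup_mono[OF upper upper] 1(1) z(1) by (blast intro: order_trans)
      next
        case 2
        obtain z1 z2 where z: "z = z1 + z2" "z1 \<perp> z2" "z1 \<sqsubseteq> x" "z2 \<sqsubseteq> y" "z1 \<sqsubseteq> z" "z2 \<sqsubseteq> z"
          using fragment_decomp[OF xy 2(2)] .
        have in_A: "inf (R z1) (f - R a) \<in> A x" "inf (R z2) (f - R a) \<in> A y"
          using z 2(3) fragment_trans unfolding A_def by blast+
        have "g \<le> inf (f - R a) (sup (R z1) (R z2))"
          unfolding 2(1) z(1) using RD(4)[OF z(2)] by (auto intro: le_infI1)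
        also have "\<dots> = sup (inf (R z1) (f - R a)) (inf (R z2) (f - R a))"
          by (simp only: inf_sup_distrib_group inf_commute)
        also have "\<dots> \<le> sup (R' x) (R' y)"
          by (intro sup_mono upper in_A)
        finally show ?thesis .
      qed
    qed
    \<comment> \<open>The choices \<open>z = a\<close> and \<open>z = w\<close> contribute
      \<open>R a\<close> and its complement, whose join is \<open>f\<close>.\<close>
    have "R a \<in> A w"
      using \<open>a \<sqsubseteq> w\<close> fragment_refl unfolding A_def by blast
    moreover have "f - R a = inf (R w) (f - R a)"
      using RD(5) components_nonneg[OF RD(1), of a] by (simp add: inf_absorb2)
    then have "f - R a \<in> A w"
      using fragment_refl unfolding A_def by blast
    ultimately have "sup (R a) (f - R a) \<le> R' w"
      by (intro le_supI upper)
    moreover have "sup (R a) (f - R a) = f"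
      using RD(1)[of a] by (simp add: components_def sup_eq_add_of_inf_eq_0)
    ultimately show "R' w = f"
      using components_le[OF comp] by (intro antisym) simp_all
  qed
  then have "R' = R"
    using le_R min by (simp add: le_fun_def)
  then have "R y = Sup (A y)"
    by (subst R'_def[symmetric]) simp
  then show ?thesis
    unfolding A_def .
qed

text \<open>For a fragment \<open>a\<close> of \<open>w\<close> disjoint from \<open>v\<close>,
  common fragments of \<open>v\<close> and \<open>a\<close> are \<open>0\<close>, so the formula for
  \<open>R v\<close> only has terms below \<open>f - R a\<close>. The general case reduces to this
  one.\<close>

lemma minimal_maxitive_minorant_disjoint:
  fixes R :: "'a::vector_lattice \<Rightarrow> 'b::dedekind_complete_vector_lattice"
  assumes R: "R \<in> maxitive_minorants T f w" and "T 0 = 0"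
    and min: "\<forall>R'\<in>maxitive_minorants T f w. R' \<le> R \<longrightarrow> R' = R"
    and "x \<perp> y"
  shows "inf (R x) (R y) = 0"
proof -
  note RD = maxitive_minorantsD[OF R]
  have "R 0 = 0"
    using RD(2)[of 0] components_nonneg[OF RD(1)[of 0]] \<open>T 0 = 0\<close> by simp
  have nonneg: "0 \<le> R z" for z
    using RD(1) by (rule components_nonneg)
  have frag: "inf (R a) (R v) = 0" if a: "a \<sqsubseteq> w" "a \<perp> v" for a v
  proof -
    have "R v \<le> f - R a"
      unfolding minimal_maxitive_minorant_eq[OF R min a(1), of v]
    proof (rule cSup_least)
      show "{R z |z. z \<sqsubseteq> v \<and> z \<sqsubseteq> a} \<union> {inf (R z) (f - R a) |z. z \<sqsubseteq> v \<and> z \<sqsubseteq> w} \<noteq> {}"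
        using fragment_zero by auto
      fix g assume "g \<in> {R z |z. z \<sqsubseteq> v \<and> z \<sqsubseteq> a} \<union> {inf (R z) (f - R a) |z. z \<sqsubseteq> v \<and> z \<sqsubseteq> w}"
      then consider z where "g = R z" "z \<sqsubseteq> v" "z \<sqsubseteq> a" | z where "g = inf (R z) (f - R a)"
        by blast
      then show "g \<le> f - R a"
      proof cases
        case 1
        then have "g = 0"
          using fragment_eq_0_of_perp[OF _ _ a(2)] \<open>R 0 = 0\<close> by blast
        then show ?thesis
          using components_le[OF RD(1)] by simp
      qed simp
    qed
    then have "inf (R a) (R v) \<le> inf (R a) (f - R a)"
      by (intro inf_mono order_refl)
    also have "\<dots> = 0"
      using RD(1)[of a] by (simp add: components_def)
    finally show ?thesis
      using nonneg by (intro antisym) simp_all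
  qed
  \<comment> \<open>With \<open>w\<close> in place of \<open>a\<close>, the complement
    \<open>f - R w\<close> is \<open>0\<close>, so \<open>R x\<close> is the supremum of
    \<open>R\<close> over the common fragments of \<open>x\<close> and \<open>w\<close>.\<close>
  let ?A = "{R z |z. z \<sqsubseteq> x \<and> z \<sqsubseteq> w} \<union> {inf (R z) (f - R w) |z. z \<sqsubseteq> x \<and> z \<sqsubseteq> w}"
  have "inf (Sup ?A) (R y) = 0"
  proof (rule inf_cSup_eq_0)
    show "?A \<noteq> {}"
      using fragment_zero by auto
    show "bdd_above ?A"
      using RD(1) by (intro bdd_above_components[where f = f])
        (auto intro: components_inf components_compl)
    have "inf (R z) (R y) = 0" if "z \<sqsubseteq> x" "z \<sqsubseteq> w" for z
      using that(2) perp_mono[OF \<open>x \<perp> y\<close> fragment_abs_le[OF that(1)]] by (rule frag)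
    then show "inf g (R y) = 0" if "g \<in> ?A" for g
      using that nonneg RD(5) by (auto simp: inf_absorb1 inf_absorb2)
  qed
  then show ?thesis
    by (simp flip: minimal_maxitive_minorant_eq[OF R min fragment_refl])
qed

section \<open>Operators attaining \<open>lambda_fun\<close>, and the equivalence\<close>

text \<open>A minimal maxitive minorant serves. Its value at a disjoint sum is the join of two
  disjoint values, which is their sum; it is order bounded because all values lie between
  \<open>0\<close> and \<open>f\<close>.\<close>

lemma exists_disjointness_preserving_minorant:
  fixes T :: "'a::vector_lattice \<Rightarrow> 'b::dedekind_complete_vector_lattice"
  assumes T: "orthogonally_additive T" "positive_operator T"
  shows "\<exists>S\<in>uryson_operators. disjointness_preserving S \<and> positive_operator S \<and> S \<le> T \<and>
    S w = lambda_fun T w"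
proof -
  define f where "f = lambda_fun T w"
  have "maxitive_minorants T f w \<noteq> {}"
    unfolding f_def by (intro maxitive_minorants_nonempty T lambda_fun_nonneg lambda_fun_le_if_fine)
  then obtain S where S: "S \<in> maxitive_minorants T f w"
    and min: "\<forall>R'\<in>maxitive_minorants T f w. R' \<le> S \<longrightarrow> R' = S"
    using maxitive_minorants_minimal by blast
  note SD = maxitive_minorantsD[OF S]
  have disj: "inf (S x) (S y) = 0" if "x \<perp> y" for x y
    using minimal_maxitive_minorant_disjoint[OF S orthogonally_additive_zero[OF T(1)] min that] .
  have nonneg: "0 \<le> S x" for x
    using SD(1) by (rule components_nonneg)
  have "S (x + y) = S x + S y" if "x \<perp> y" for x y
  proof -
    have "x \<sqsubseteq> x + y" "y \<sqsubseteq> x + y"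
      using that fragment_add[of x y] fragment_add[of y x]
      by (simp_all add: perp_commute add.commute)
    then have "S (x + y) = sup (S x) (S y)"
      using SD(4)[OF that] SD(3) by (intro antisym le_supI)
    then show ?thesis
      using disj[OF that] by (simp add: sup_eq_add_of_inf_eq_0)
  qed
  moreover have "order_bounded (S ` A)" for A
    using SD(1) unfolding order_bounded_def
    by (intro conjI bdd_above_components[where f = f] bdd_below_components[where f = f]) auto
  ultimately have "S \<in> uryson_operators"
    by (simp add: uryson_operators_def orthogonally_additive_def)
  moreover have "disjointness_preserving S"
    using disj nonneg by (simp add: disjointness_preserving_def perp_def)
  ultimately show ?thesis
    using nonneg SD(2,5) unfolding f_def positive_operator_def le_fun_def by blast
qed

theorem theorem9p1:
  fixes T :: "'a::vector_lattice \<Rightarrow> 'b::dedekind_complete_vector_lattice"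
  assumes "atomless TYPE('a)"
    and "projection_property TYPE('a)"
    and "T \<in> uryson_operators"
    and "positive_operator T"
    and "laterally_continuous T"
  shows "lambda_narrow T \<longleftrightarrow> pseudo_narrow T"
proof -
  have T: "orthogonally_additive T" "positive_operator T"
    using assms(3,4) by (simp_all add: uryson_operators_def)
  have modulus: "uryson_modulus T = T"
    using assms(3,4) by (rule uryson_modulus_positive)
  show ?thesis
  proof
    assume narrow: "lambda_narrow T"
    have "S = (\<lambda>x. 0)"
      if "S \<in> uryson_operators" "disjointness_preserving S" "positive_operator S" "S \<le> T" for S
    proof
      fix x
      have "orthogonally_additive S"
        using that(1) by (simp add: uryson_operators_def)
      then have "S x \<le> lambda_fun T x"
        using that by (intro disjointness_preserving_le_lambda_fun)
      then show "S x = 0"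
        using narrow that(3) by (intro antisym) (simp_all add: lambda_narrow_def positive_operator_def)
    qed
    then show "pseudo_narrow T"
      unfolding pseudo_narrow_def modulus by blast
  next
    assume narrow: "pseudo_narrow T"
    show "lambda_narrow T"
      unfolding lambda_narrow_def
    proof
      fix w
      obtain S where "S \<in> uryson_operators" "disjointness_preserving S" "positive_operator S" "S \<le> T"
        "S w = lambda_fun T w"
        using exists_disjointness_preserving_minorant[OF T] by blast
      \<comment> \<open>Pseudo-narrowness leaves only the zero operator for
        \<open>S\<close>.\<close>
      then show "lambda_fun T w = 0"
        using narrow unfolding pseudo_narrow_def modulus by metis
    qed
  qed
qed

end
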